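(* Let $R$ be a commutative ring with unity and let $M$ be an $R$-module with $\operatorname{Spec}(M)\neq\emptyset$. Then $\widetilde{\operatorname{Spec}(M)}$ is a nested space if and only if the set $\{(P:M) \mid P\in\operatorname{Spec}(M)\}$ is totally ordered by inclusion.
   Context: For a submodule $N$ of an $R$-module $M$, $(N:M)=\{r\in R : rM\subseteq N\}$. A proper submodule $P$ of $M$ is prime if whenever $rm\in P$ with $r\in R$, $m\in M$, then $m\in P$ or $r\in(P:M)$; in this case $(P:M)$ is a prime ideal of $R$. $\operatorname{Spec}(M)$ is the set of all prime submodules of $M$. A subset $T\subseteq R$ is multiplicatively closed if $1\in T$ and $xy\in T$ whenever $x,y\in T$. For a family $\mathcal{S}=\{S_i\}_{i\in I}$ of multiplicatively closed subsets of $R$, $\widetilde{V}(\mathcal{S})=\{P\in\operatorname{Spec}(M) \mid (P:M)\cap S_i\neq\emptyset \text{ for all } i\in I\}$. $\widetilde{\operatorname{Spec}(M)}$ denotes the set $\operatorname{Spec}(M)$ with the topology whose closed sets are exactly the sets $\widetilde{V}(\mathcal{S})$, $\mathcal{S}$ ranging over all families of multiplicatively closed subsets of $R$. A topological space is nested if any two of its open sets are comparable with respect to inclusion. *)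

theory Defs
  imports "HOL-Algebra.Module" "HOL-Analysis.Abstract_Topology"
begin

definition residual :: "('a, 'm) ring_scheme \<Rightarrow> ('a, 'b, 'n) module_scheme \<Rightarrow> 'b set \<Rightarrow> 'a set" where
  "residual R M N = {r \<in> carrier R. \<forall>m \<in> carrier M. r \<odot>\<^bsub>M\<^esub> m \<in> N}"

definition prime_submodule :: "('a, 'm) ring_scheme \<Rightarrow> ('a, 'b, 'n) module_scheme \<Rightarrow> 'b set \<Rightarrow> bool" where
  "prime_submodule R M P \<longleftrightarrow> submodule P R M \<and> P \<noteq> carrier M \<and>
     (\<forall>r \<in> carrier R. \<forall>m \<in> carrier M. r \<odot>\<^bsub>M\<^esub> m \<in> P \<longrightarrow> m \<in> P \<or> r \<in> residual R M P)"

definition Spec :: "('a, 'm) ring_scheme \<Rightarrow> ('a, 'b, 'n) module_scheme \<Rightarrow> 'b set set" where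
  "Spec R M = {P. prime_submodule R M P}"

(* A family enters only through the set of its members, so families are sets of sets.
   The empty family is allowed and yields the whole spectrum. *)
definition V_tilde :: "('a, 'm) ring_scheme \<Rightarrow> ('a, 'b, 'n) module_scheme \<Rightarrow> 'a set set \<Rightarrow> 'b set set" where
  "V_tilde R M \<S> = {P \<in> Spec R M. \<forall>S \<in> \<S>. residual R M P \<inter> S \<noteq> {}}"

(* The qualified name Module.module below selects the HOL-Algebra module locale rather than HOL.Modules.
   A multiplicatively closed subset (containing the identity) is a submonoid of the multiplicative
   monoid of R. The topology constructor is meaningful here by Spec_tilde_istopology; the resulting
   closed sets are described by closedin_Spec_tilde. *)
definition Spec_tilde :: "('a, 'm) ring_scheme \<Rightarrow> ('a, 'b, 'n) module_scheme \<Rightarrow> 'b set topology" where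
  "Spec_tilde R M = topology (\<lambda>U. U \<subseteq> Spec R M \<and>
     (\<exists>\<S>. (\<forall>S \<in> \<S>. submonoid S R) \<and> Spec R M - U = V_tilde R M \<S>))"

definition nested_space :: "'a topology \<Rightarrow> bool" where
  "nested_space X \<longleftrightarrow> (\<forall>U V. openin X U \<longrightarrow> openin X V \<longrightarrow> U \<subseteq> V \<or> V \<subseteq> U)"

context Module.module
begin

lemma one_notin_residual:
  assumes "P \<in> Spec R M"
  shows "\<one> \<notin> residual R M P"
proof
  assume "\<one> \<in> residual R M P"
  then have "carrier M \<subseteq> P"
    by (auto simp: residual_def)
  moreover have "P \<subseteq> carrier M" "P \<noteq> carrier M"
    using assms submoduleE(1) by (auto simp: Spec_def prime_submodule_def)
  ultimately show False
    by blast
qed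

lemma residual_mult_iff:
  assumes P: "P \<in> Spec R M" and a: "a \<in> carrier R" and b: "b \<in> carrier R"
  shows "a \<otimes> b \<in> residual R M P \<longleftrightarrow> a \<in> residual R M P \<or> b \<in> residual R M P"
proof
  assume ab: "a \<otimes> b \<in> residual R M P"
  show "a \<in> residual R M P \<or> b \<in> residual R M P"
  proof (rule disjCI)
    assume nb: "b \<notin> residual R M P"
    then obtain m where m: "m \<in> carrier M" "b \<odot>\<^bsub>M\<^esub> m \<notin> P"
      using b by (auto simp: residual_def)
    moreover have "a \<odot>\<^bsub>M\<^esub> (b \<odot>\<^bsub>M\<^esub> m) \<in> P"
      using ab m a b by (auto simp: residual_def smult_assoc1)
    ultimately show "a \<in> residual R M P"
      using P a b by (auto simp: Spec_def prime_submodule_def)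
  qed
next
  have closed: "c \<odot>\<^bsub>M\<^esub> x \<in> P" if "c \<in> carrier R" "x \<in> P" for c x
    using P that submoduleE(4) by (auto simp: Spec_def prime_submodule_def)
  assume "a \<in> residual R M P \<or> b \<in> residual R M P"
  then show "a \<otimes> b \<in> residual R M P"
    using a b closed by (auto simp: residual_def smult_assoc1)
qed

lemma V_tilde_Un:
  assumes \<S>: "\<forall>S \<in> \<S>. submonoid S R" and \<T>: "\<forall>T \<in> \<T>. submonoid T R"
  obtains \<U> where "\<forall>U \<in> \<U>. submonoid U R"
    "V_tilde R M \<S> \<union> V_tilde R M \<T> = V_tilde R M \<U>"
proof -
  define p where "p S T = {s \<otimes> t | s t. s \<in> S \<and> t \<in> T}" for S T
  have sub: "submonoid (p S T) R" if "submonoid S R" "submonoid T R" for S T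
  proof -
    interpret S: submonoid S R by fact
    interpret T: submonoid T R by fact
    show ?thesis
    proof
      show "p S T \<subseteq> carrier R" by (auto simp: p_def)
      have "\<one> \<otimes> \<one> \<in> p S T"
        using S.one_closed T.one_closed unfolding p_def by blast
      then show "\<one> \<in> p S T"
        by simp
    next
      fix x y assume "x \<in> p S T" "y \<in> p S T"
      then obtain s t s' t' where st: "s \<in> S" "t \<in> T" "s' \<in> S" "t' \<in> T"
          "x = s \<otimes> t" "y = s' \<otimes> t'"
        by (auto simp: p_def)
      then have "x \<otimes> y = (s \<otimes> s') \<otimes> (t \<otimes> t')"
        by (simp add: R.m_ac)
      then show "x \<otimes> y \<in> p S T"
        using st by (auto simp: p_def)
    qed
  qed
  have meets: "residual R M P \<inter> p S T \<noteq> {} \<longleftrightarrow>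
      residual R M P \<inter> S \<noteq> {} \<or> residual R M P \<inter> T \<noteq> {}"
    if P: "P \<in> Spec R M" and "submonoid S R" "submonoid T R" for P S T
  proof -
    interpret S: submonoid S R by fact
    interpret T: submonoid T R by fact
    show ?thesis
    proof
      assume "residual R M P \<inter> p S T \<noteq> {}"
      then obtain s t where "s \<in> S" "t \<in> T" "s \<otimes> t \<in> residual R M P"
        by (auto simp: p_def)
      then show "residual R M P \<inter> S \<noteq> {} \<or> residual R M P \<inter> T \<noteq> {}"
        using residual_mult_iff[OF P, of s t] S.mem_carrier T.mem_carrier by blast
    next
      assume "residual R M P \<inter> S \<noteq> {} \<or> residual R M P \<inter> T \<noteq> {}"
      then obtain s t where st: "s \<in> S" "t \<in> T" "s \<in> residual R M P \<or> t \<in> residual R M P"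
        using S.one_closed T.one_closed by blast
      then have "s \<otimes> t \<in> residual R M P"
        using residual_mult_iff[OF P, of s t] S.mem_carrier T.mem_carrier by blast
      moreover have "s \<otimes> t \<in> p S T"
        using st by (auto simp: p_def)
      ultimately show "residual R M P \<inter> p S T \<noteq> {}"
        by blast
    qed
  qed
  define \<U> where "\<U> = {p S T | S T. S \<in> \<S> \<and> T \<in> \<T>}"
  have "\<forall>U \<in> \<U>. submonoid U R"
    using sub \<S> \<T> by (auto simp: \<U>_def)
  moreover have "P \<in> V_tilde R M \<S> \<union> V_tilde R M \<T> \<longleftrightarrow> P \<in> V_tilde R M \<U>" for P
  proof (cases "P \<in> Spec R M")
    case True
    then have "P \<in> V_tilde R M \<U> \<longleftrightarrow> (\<forall>S \<in> \<S>. \<forall>T \<in> \<T>. residual R M P \<inter> p S T \<noteq> {})"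
      by (auto simp: V_tilde_def \<U>_def)
    also have "\<dots> \<longleftrightarrow> (\<forall>S \<in> \<S>. \<forall>T \<in> \<T>. residual R M P \<inter> S \<noteq> {} \<or> residual R M P \<inter> T \<noteq> {})"
      using meets[OF True] \<S> \<T> by simp
    also have "\<dots> \<longleftrightarrow> P \<in> V_tilde R M \<S> \<union> V_tilde R M \<T>"
      using True unfolding V_tilde_def by blast
    finally show ?thesis ..
  qed (simp add: V_tilde_def)
  ultimately show ?thesis
    using that by blast
qed

lemma Spec_tilde_istopology:
  "istopology (\<lambda>U. U \<subseteq> Spec R M \<and>
     (\<exists>\<S>. (\<forall>S \<in> \<S>. submonoid S R) \<and> Spec R M - U = V_tilde R M \<S>))" (is "istopology ?L")
  unfolding istopology_def
proof (intro conjI allI impI)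
  fix U V assume "?L U" "?L V"
  then obtain \<S> \<T> where *: "U \<subseteq> Spec R M" "V \<subseteq> Spec R M"
      "\<forall>S \<in> \<S>. submonoid S R" "\<forall>T \<in> \<T>. submonoid T R"
      "Spec R M - U = V_tilde R M \<S>" "Spec R M - V = V_tilde R M \<T>"
    by blast
  obtain \<U> where "\<forall>S \<in> \<U>. submonoid S R" "V_tilde R M \<S> \<union> V_tilde R M \<T> = V_tilde R M \<U>"
    by (rule V_tilde_Un[OF *(3,4)])
  moreover have "Spec R M - (U \<inter> V) = V_tilde R M \<S> \<union> V_tilde R M \<T>"
    using * by blast
  ultimately show "U \<inter> V \<subseteq> Spec R M"
      "\<exists>\<S>. (\<forall>S \<in> \<S>. submonoid S R) \<and> Spec R M - (U \<inter> V) = V_tilde R M \<S>"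
    using *(1) by auto
next
  fix \<K> assume K: "\<forall>U \<in> \<K>. ?L U"
  then show "\<Union>\<K> \<subseteq> Spec R M" by blast
  from K obtain f where f: "\<forall>U \<in> \<K>. (\<forall>S \<in> f U. submonoid S R) \<and> Spec R M - U = V_tilde R M (f U)"
    using bchoice[of \<K> "\<lambda>U \<S>. (\<forall>S \<in> \<S>. submonoid S R) \<and> Spec R M - U = V_tilde R M \<S>"]
    by blast
  show "\<exists>\<S>. (\<forall>S \<in> \<S>. submonoid S R) \<and> Spec R M - \<Union>\<K> = V_tilde R M \<S>"
  proof (intro exI conjI)
    show "\<forall>S \<in> \<Union>(f ` \<K>). submonoid S R" using f by blast
    have "P \<notin> U \<longleftrightarrow> P \<in> V_tilde R M (f U)" if "P \<in> Spec R M" "U \<in> \<K>" for P U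
      using f that by blast
    then have "Spec R M - \<Union>\<K> = {P \<in> Spec R M. \<forall>U \<in> \<K>. P \<in> V_tilde R M (f U)}"
      by blast
    then show "Spec R M - \<Union>\<K> = V_tilde R M (\<Union>(f ` \<K>))"
      by (auto simp: V_tilde_def)
  qed
qed

lemma openin_Spec_tilde:
  "openin (Spec_tilde R M) U \<longleftrightarrow> U \<subseteq> Spec R M \<and>
     (\<exists>\<S>. (\<forall>S \<in> \<S>. submonoid S R) \<and> Spec R M - U = V_tilde R M \<S>)"
  by (simp add: Spec_tilde_def topology_inverse'[OF Spec_tilde_istopology])

lemma topspace_Spec_tilde: "topspace (Spec_tilde R M) = Spec R M"
proof -
  have "submonoid {\<one>} R"
    by unfold_locales auto
  moreover have "Spec R M - Spec R M = V_tilde R M {{\<one>}}"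
    using one_notin_residual by (auto simp: V_tilde_def)
  ultimately have "openin (Spec_tilde R M) (Spec R M)"
    unfolding openin_Spec_tilde by (intro conjI exI[of _ "{{\<one>}}"]) auto
  then show ?thesis
    by (metis openin_Spec_tilde openin_subset openin_topspace subset_antisym)
qed

lemma closedin_Spec_tilde:
  "closedin (Spec_tilde R M) C \<longleftrightarrow> (\<exists>\<S>. (\<forall>S \<in> \<S>. submonoid S R) \<and> C = V_tilde R M \<S>)"
proof -
  have "V_tilde R M \<S> \<subseteq> Spec R M" for \<S>
    by (auto simp: V_tilde_def)
  then show ?thesis
    unfolding closedin_def openin_Spec_tilde topspace_Spec_tilde
    by (auto simp: double_diff)
qed

end

end

theory Submission
  imports Defs
begin

text \<open>The open sets are downward closed in \<open>P \<mapsto> (P:M)\<close>, and the complement of \<open>(P:M)\<close>, being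
  multiplicatively closed, makes each principal down-set \<open>{Q. (Q:M) \<subseteq> (P:M)}\<close> open. Hence the open
  sets are nested exactly when the preorder is total.\<close>

context Module.module
begin

text \<open>A larger residual meets every set that a smaller one meets, so each closed set
  \<open>V_tilde R M \<S>\<close> is upward closed in the residual; a \<open>Q\<close> outside
  \<open>U\<close> would force \<open>P\<close> outside \<open>U\<close>.\<close>

lemma openin_Spec_tilde_downward:
  assumes U: "openin (Spec_tilde R M) U" and P: "P \<in> U"
    and Q: "Q \<in> Spec R M" and le: "residual R M Q \<subseteq> residual R M P"
  shows "Q \<in> U"
proof (rule ccontr)
  assume "Q \<notin> U"
  obtain \<S> where "U \<subseteq> Spec R M" and \<S>: "Spec R M - U = V_tilde R M \<S>"
    using U unfolding openin_Spec_tilde by blast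
  have "Q \<in> V_tilde R M \<S>"
    using \<open>Q \<notin> U\<close> Q \<S> by blast
  moreover have "P \<in> Spec R M"
    using P \<open>U \<subseteq> Spec R M\<close> by blast
  ultimately have "P \<in> V_tilde R M \<S>"
    using le unfolding V_tilde_def by blast
  then show False
    using P \<S> by blast
qed

text \<open>This is primality of the ideal \<open>(P:M)\<close>: it omits the unit, and a product
  lies in it only if a factor does.\<close>

lemma submonoid_Compl_residual:
  assumes "P \<in> Spec R M"
  shows "submonoid (carrier R - residual R M P) R"
  using one_notin_residual[OF assms] residual_mult_iff[OF assms]
  by (intro submonoid.intro) simp_all

lemma openin_Spec_tilde_atMost:
  assumes "P \<in> Spec R M"
  shows "openin (Spec_tilde R M) {Q \<in> Spec R M. residual R M Q \<subseteq> residual R M P}"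
proof -
  \<comment> \<open>Residuals lie in \<open>carrier R\<close>, so a one-member family already
    detects failure of inclusion.\<close>
  have "residual R M Q \<inter> (carrier R - residual R M P) \<noteq> {} \<longleftrightarrow>
      \<not> residual R M Q \<subseteq> residual R M P" for Q
    unfolding residual_def by blast
  then have "Spec R M - {Q \<in> Spec R M. residual R M Q \<subseteq> residual R M P}
      = V_tilde R M {carrier R - residual R M P}"
    unfolding V_tilde_def by auto
  then show ?thesis
    unfolding openin_Spec_tilde using submonoid_Compl_residual[OF assms]
    by (intro conjI exI[of _ "{carrier R - residual R M P}"]) auto
qed

lemma nested_space_Spec_tilde_iff:
  "nested_space (Spec_tilde R M) \<longleftrightarrow> chain\<^sub>\<subseteq> {residual R M P | P. P \<in> Spec R M}"
proof
  assume nested: "nested_space (Spec_tilde R M)"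
  have "residual R M P \<subseteq> residual R M Q \<or> residual R M Q \<subseteq> residual R M P"
    if "P \<in> Spec R M" "Q \<in> Spec R M" for P Q
  proof -
    let ?D = "\<lambda>P. {Q \<in> Spec R M. residual R M Q \<subseteq> residual R M P}"
    have "?D P \<subseteq> ?D Q \<or> ?D Q \<subseteq> ?D P"
      using nested openin_Spec_tilde_atMost[OF that(1)] openin_Spec_tilde_atMost[OF that(2)]
      unfolding nested_space_def by presburger
    \<comment> \<open>By reflexivity, \<open>P\<close> and \<open>Q\<close> each lie in their own
      down-set, so the inclusion of one down-set in the other compares the residuals.\<close>
    then show ?thesis
      using that by blast
  qed
  then show "chain\<^sub>\<subseteq> {residual R M P | P. P \<in> Spec R M}"
    unfolding chain_subset_def by blast
next
  assume chain: "chain\<^sub>\<subseteq> {residual R M P | P. P \<in> Spec R M}"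
  show "nested_space (Spec_tilde R M)"
    unfolding nested_space_def
  proof (intro allI impI disjCI subsetI)
    fix U V P
    assume U: "openin (Spec_tilde R M) U" and V: "openin (Spec_tilde R M) V"
      and "\<not> V \<subseteq> U" and P: "P \<in> U"
    then obtain Q where Q: "Q \<in> V" "Q \<notin> U"
      by blast
    have PQ: "P \<in> Spec R M" "Q \<in> Spec R M"
      using U V P Q unfolding openin_Spec_tilde by blast+
    then have "residual R M P \<subseteq> residual R M Q \<or> residual R M Q \<subseteq> residual R M P"
      using chain unfolding chain_subset_def by blast
    \<comment> \<open>If \<open>(P:M)\<close> is the smaller residual, \<open>P\<close> descends
      into \<open>V\<close> from \<open>Q\<close>; otherwise \<open>Q\<close> would descend into
      \<open>U\<close> from \<open>P\<close>, contrary to its choice.\<close>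
    then show "P \<in> V"
      using openin_Spec_tilde_downward[OF V Q(1) PQ(1)] openin_Spec_tilde_downward[OF U P PQ(2)] Q(2)
      by argo
  qed
qed

end

theorem theorem3:
  fixes R :: "('a, 'm) ring_scheme" and M :: "('a, 'b, 'n) module_scheme"
  assumes "Module.module R M" and "Spec R M \<noteq> {}"
  shows "nested_space (Spec_tilde R M) \<longleftrightarrow> chain\<^sub>\<subseteq> {residual R M P | P. P \<in> Spec R M}"
  using assms(1) by (rule module.nested_space_Spec_tilde_iff)

end
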